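(* Let $\Gamma$ be a countable discrete group satisfying the weak Rohlin property, and let $\mathbb{A}$ be the space of measure-preserving $\Gamma$-actions on the probability space $(Y,\mathcal{Y},\mathbf{m})$, with the coarse topology. Let $B\subset\mathbb{A}$ be a dynamical property, i.e. a Baire set that is invariant under isomorphism ($\varphi\mathbf{T}\varphi^{-1}\in B$ for every $\mathbf{T}\in B$ and every $\varphi\in\Phi$). Then $B$ is either meager or residual in $\mathbb{A}$.
   Context: $Y=[0,1)$ is topologized as the unit circle, $\mathcal{Y}$ is its Borel sigma-algebra and $\mathbf{m}$ is Lebesgue measure. The group $\Gamma$ is written additively (though possibly non-abelian), with identity $0$. A $\Gamma$-action is a collection $\mathbf{T}=\{T^\gamma\mid\gamma\in\Gamma\}$ of measure-preserving transformations of $(Y,\mathcal{Y},\mathbf{m})$ with $T^{\beta+\alpha}=T^\beta\circ T^\alpha$ and with $(\gamma,y)\mapsto T^\gamma(y)$ measurable; transformations equal almost everywhere are identified. $\mathbb{A}$ is the set of all $\Gamma$-actions. Coarse topology: for measure-preserving transformations, $T_i\to R$ iff $\mathbf{m}(T_i^{-1}(E)\bigtriangleup R^{-1}(E))\to 0$ for every measurable $E\subset Y$; on $\mathbb{A}$, $\mathbf{T}_i\to\mathbf{R}$ iff $T_i^\gamma\to R^\gamma$ for every $\gamma\in\Gamma$ (net convergence in both cases). $\Phi$ is the group of invertible bi-measurable measure-preserving maps of $(Y,\mathcal{Y},\mathbf{m})$ (modulo null sets), acting on $\mathbb{A}$ by $\varphi(\mathbf{T})=\varphi\mathbf{T}\varphi^{-1}:=\{\varphi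 T^\gamma\varphi^{-1}\mid\gamma\in\Gamma\}$. $\Gamma$ has the weak Rohlin property if for some $\mathbf{T}\in\mathbb{A}$ the orbit $\Phi(\mathbf{T})=\{\varphi\mathbf{T}\varphi^{-1}\mid\varphi\in\Phi\}$ is dense in $\mathbb{A}$. A subset of a topological space is meager if it is a countable union of nowhere-dense sets, residual if its complement is meager, and a Baire set if it equals $V\bigtriangleup M$ for some open $V$ and some meager $M$. *)

theory Defs
  imports "HOL-Analysis.Analysis"
begin

text \<open>The circle topology and the subspace topology on \<open>[0,1)\<close> have the same Borel sets.\<close>

definition Y :: "real measure" where
  "Y = restrict_space lborel {0..<1}"

definition measure_preserving :: "(real \<Rightarrow> real) \<Rightarrow> bool" where
  "measure_preserving f \<longleftrightarrow>
     f \<in> Y \<rightarrow>\<^sub>M Y \<and> (\<forall>E\<in>sets Y. emeasure Y (f -` E \<inter> space Y) = emeasure Y E)"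

lemma space_Y [simp]: "space Y = {0..<1}"
  by (simp add: Y_def space_restrict_space)

lemma finite_measure_Y: "finite_measure Y"
  by (rule finite_measureI) (simp add: Y_def space_restrict_space emeasure_restrict_space)

lemma measure_preserving_id: "measure_preserving (\<lambda>y. y)"
  unfolding measure_preserving_def by (auto dest: sets.Int_space_eq2)

lemma measure_preserving_comp:
  assumes f: "measure_preserving f" and g: "measure_preserving g"
  shows "measure_preserving (f \<circ> g)"
  unfolding measure_preserving_def
proof safe
  show "f \<circ> g \<in> Y \<rightarrow>\<^sub>M Y"
    using f g unfolding measure_preserving_def by (auto intro: measurable_comp)
next
  fix E assume E: "E \<in> sets Y"
  have g': "g \<in> Y \<rightarrow>\<^sub>M Y" and f': "f \<in> Y \<rightarrow>\<^sub>M Y"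
    using f g by (auto simp: measure_preserving_def)
  have m: "f -` E \<inter> space Y \<in> sets Y"
    using measurable_sets[OF f' E] .
  have "(f \<circ> g) -` E \<inter> space Y = g -` (f -` E \<inter> space Y) \<inter> space Y"
    using measurable_space[OF g'] by auto
  also have "emeasure Y \<dots> = emeasure Y (f -` E \<inter> space Y)"
    using g m unfolding measure_preserving_def by blast
  also have "\<dots> = emeasure Y E"
    using f E unfolding measure_preserving_def by blast
  finally show "emeasure Y ((f \<circ> g) -` E \<inter> space Y) = emeasure Y E" .
qed

lemma measure_preserving_AE:
  assumes g: "measure_preserving g" and P: "AE y in Y. P y"
  shows "AE y in Y. P (g y)"
proof -
  from P obtain N where N: "{y \<in> space Y. \<not> P y} \<subseteq> N" "emeasure Y N = 0" "N \<in> sets Y"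
    by (rule AE_E)
  have g': "g \<in> Y \<rightarrow>\<^sub>M Y" using g by (simp add: measure_preserving_def)
  show ?thesis
  proof (rule AE_I)
    show "{y \<in> space Y. \<not> P (g y)} \<subseteq> g -` N \<inter> space Y"
      using N(1) measurable_space[OF g'] by blast
    show "emeasure Y (g -` N \<inter> space Y) = 0"
      using g N by (simp add: measure_preserving_def)
    show "g -` N \<inter> space Y \<in> sets Y"
      using measurable_sets[OF g' N(3)] .
  qed
qed

definition ae_equal :: "(real \<Rightarrow> real) \<Rightarrow> (real \<Rightarrow> real) \<Rightarrow> bool" where
  "ae_equal f g \<longleftrightarrow> measure_preserving f \<and> measure_preserving g \<and> (AE y in Y. f y = g y)"

quotient_type mpt = "real \<Rightarrow> real" / partial: ae_equal
  morphisms rep_mpt abs_mpt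
proof (rule part_equivpI)
  show "\<exists>x. ae_equal x x"
    using measure_preserving_id unfolding ae_equal_def by auto
  show "symp ae_equal"
    unfolding ae_equal_def by (rule sympI) (auto simp: eq_commute)
  show "transp ae_equal"
    unfolding ae_equal_def by (rule transpI) (auto elim: AE_mp)
qed

lift_definition mpt_id :: mpt is "\<lambda>y. y"
  by (simp add: ae_equal_def measure_preserving_id)

lift_definition mpt_comp :: "mpt \<Rightarrow> mpt \<Rightarrow> mpt" (infixl "\<odot>" 70) is "\<lambda>f g. f \<circ> g"
proof -
  fix f f' g g' assume f: "ae_equal f f'" and g: "ae_equal g g'"
  have "AE y in Y. f (g y) = f' (g y)"
    using f g by (intro measure_preserving_AE[of g]) (auto simp: ae_equal_def)
  with f g show "ae_equal (f \<circ> g) (f' \<circ> g')"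
    unfolding ae_equal_def by (auto intro: measure_preserving_comp elim!: AE_mp)
qed

lemma mpt_comp_assoc: "R \<odot> S \<odot> T = R \<odot> (S \<odot> T)"
  by transfer (auto simp: ae_equal_def o_assoc intro!: measure_preserving_comp)

lemma mpt_id_comp [simp]: "mpt_id \<odot> T = T" "T \<odot> mpt_id = T"
  by (transfer; simp add: ae_equal_def comp_def)+

lemma rep_mpt_measure_preserving: "measure_preserving (rep_mpt T)"
  using Quotient3_rep_reflp[OF Quotient3_mpt, of T] by (simp add: ae_equal_def)

lemma rep_mpt_abs_mpt:
  assumes "measure_preserving f"
  shows "AE y in Y. rep_mpt (abs_mpt f) y = f y"
  using rep_abs_rsp_left[OF Quotient3_mpt, of f f] assms by (simp add: ae_equal_def)

lemma mpt_comp_abs: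
  assumes "measure_preserving f" "measure_preserving g"
  shows "abs_mpt f \<odot> abs_mpt g = abs_mpt (f \<circ> g)"
  using assms by (intro mpt_comp.abs_eq) (simp_all add: ae_equal_def)

text \<open>The choice of representatives does not matter, see \<open>mpt_diff_abs\<close> below.\<close>

definition mpt_diff :: "real set \<Rightarrow> mpt \<Rightarrow> mpt \<Rightarrow> real" where
  "mpt_diff E S T =
     measure Y (sym_diff (rep_mpt S -` E \<inter> space Y) (rep_mpt T -` E \<inter> space Y))"

lemma mpt_diff_abs:
  assumes f: "measure_preserving f" and g: "measure_preserving g" and E: "E \<in> sets Y"
  shows "mpt_diff E (abs_mpt f) (abs_mpt g) =
           measure Y (sym_diff (f -` E \<inter> space Y) (g -` E \<inter> space Y))"
  unfolding mpt_diff_def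
proof (rule measure_eq_AE)
  show "AE y in Y. (y \<in> sym_diff (rep_mpt (abs_mpt f) -` E \<inter> space Y)
                              (rep_mpt (abs_mpt g) -` E \<inter> space Y)) =
                   (y \<in> sym_diff (f -` E \<inter> space Y) (g -` E \<inter> space Y))"
    using rep_mpt_abs_mpt[OF f] rep_mpt_abs_mpt[OF g] by eventually_elim auto
qed (use f g E rep_mpt_measure_preserving in
      \<open>auto simp: measure_preserving_def simp del: space_Y intro!: sets.Un sets.Diff measurable_sets\<close>)

text \<open>The net convergence \<open>T\<^sub>i \<rightarrow> R\<close> iff \<open>m(T\<^sub>i\<^sup>-\<^sup>1 E \<triangle> R\<^sup>-\<^sup>1 E) \<rightarrow> 0\<close> for all measurable \<open>E\<close>
  is convergence in the topology generated by the balls of the pseudometrics \<open>mpt_diff E\<close>;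
  see \<open>limitin_mpt_topology\<close>.\<close>

definition mpt_topology :: "mpt topology" where
  "mpt_topology =
     topology_generated_by {{T. mpt_diff E T R < \<epsilon>} | E R \<epsilon>. E \<in> sets Y \<and> 0 < \<epsilon>}"

lemma mpt_diff_self [simp]: "mpt_diff E T T = 0"
  by (simp add: mpt_diff_def)

lemma mpt_diff_commute: "mpt_diff E S T = mpt_diff E T S"
  by (simp add: mpt_diff_def Un_commute)

lemma mpt_diff_nonneg [simp]: "0 \<le> mpt_diff E S T"
  by (simp add: mpt_diff_def)

lemma mpt_diff_triangle:
  assumes E: "E \<in> sets Y"
  shows "mpt_diff E R T \<le> mpt_diff E R S + mpt_diff E S T"
proof -
  interpret finite_measure Y by (rule finite_measure_Y)
  define A where "A T = rep_mpt T -` E \<inter> space Y" for T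
  have A: "A T \<in> sets Y" for T
    using rep_mpt_measure_preserving[of T] E
    unfolding A_def measure_preserving_def by (blast intro: measurable_sets)
  have "measure Y (sym_diff (A R) (A T)) \<le>
        measure Y (sym_diff (A R) (A S) \<union> sym_diff (A S) (A T))"
    by (rule finite_measure_mono) (use A in auto)
  also have "\<dots> \<le> measure Y (sym_diff (A R) (A S)) + measure Y (sym_diff (A S) (A T))"
    by (rule measure_Un_le) (use A in auto)
  finally show ?thesis by (simp add: mpt_diff_def A_def)
qed

lemma limitin_topology_generated_by:
  "limitin (topology_generated_by \<S>) f l F \<longleftrightarrow>
     l \<in> \<Union>\<S> \<and> (\<forall>U\<in>\<S>. l \<in> U \<longrightarrow> (\<forall>\<^sub>F i in F. f i \<in> U))"
proof
  assume "limitin (topology_generated_by \<S>) f l F"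
  then show "l \<in> \<Union>\<S> \<and> (\<forall>U\<in>\<S>. l \<in> U \<longrightarrow> (\<forall>\<^sub>F i in F. f i \<in> U))"
    by (auto simp: limitin_def intro: topology_generated_by_Basis)
next
  assume *: "l \<in> \<Union>\<S> \<and> (\<forall>U\<in>\<S>. l \<in> U \<longrightarrow> (\<forall>\<^sub>F i in F. f i \<in> U))"
  have "\<forall>\<^sub>F i in F. f i \<in> U" if "generate_topology_on \<S> U" "l \<in> U" for U
    using that
  proof induction
    case (Int a b)
    then show ?case by (auto intro: eventually_conj)
  next
    case (UN K)
    then obtain k where "k \<in> K" "\<forall>\<^sub>F i in F. f i \<in> k" by blast
    then show ?case by (auto elim!: eventually_mono)
  qed (use * in auto)
  with * show "limitin (topology_generated_by \<S>) f l F"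
    by (auto simp: limitin_def openin_topology_generated_by_iff)
qed

lemma topspace_mpt_topology [simp]: "topspace mpt_topology = UNIV"
proof -
  have "T \<in> topspace mpt_topology" for T
    unfolding mpt_topology_def topology_generated_by_topspace
  proof (rule UnionI)
    have "{} \<in> sets Y \<and> (0::real) < 1" by simp
    then show "{S. mpt_diff {} S T < 1} \<in> {{T. mpt_diff E T R < \<epsilon>} | E R \<epsilon>. E \<in> sets Y \<and> 0 < \<epsilon>}"
      by blast
  qed simp
  then show ?thesis by auto
qed

lemma limitin_mpt_topology:
  "limitin mpt_topology f R F \<longleftrightarrow> (\<forall>E\<in>sets Y. ((\<lambda>i. mpt_diff E (f i) R) \<longlongrightarrow> 0) F)"
proof
  assume lim: "limitin mpt_topology f R F"
  show "\<forall>E\<in>sets Y. ((\<lambda>i. mpt_diff E (f i) R) \<longlongrightarrow> 0) F"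
  proof
    fix E assume E: "E \<in> sets Y"
    show "((\<lambda>i. mpt_diff E (f i) R) \<longlongrightarrow> 0) F"
    proof (rule tendstoI)
      fix e :: real assume "0 < e"
      with E have "openin mpt_topology {T. mpt_diff E T R < e}"
        unfolding mpt_topology_def by (intro topology_generated_by_Basis) auto
      moreover have "R \<in> {T. mpt_diff E T R < e}"
        using \<open>0 < e\<close> by simp
      ultimately have "\<forall>\<^sub>F i in F. f i \<in> {T. mpt_diff E T R < e}"
        using lim unfolding limitin_def by blast
      then show "\<forall>\<^sub>F i in F. dist (mpt_diff E (f i) R) 0 < e"
        by simp
    qed
  qed
next
  assume conv: "\<forall>E\<in>sets Y. ((\<lambda>i. mpt_diff E (f i) R) \<longlongrightarrow> 0) F"
  have "\<forall>\<^sub>F i in F. mpt_diff E (f i) S < e"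
    if E: "E \<in> sets Y" and e: "mpt_diff E R S < e" for E S e
  proof -
    have "\<forall>\<^sub>F i in F. mpt_diff E (f i) R < e - mpt_diff E R S"
      using conv E e by (intro order_tendstoD(2)[of _ 0]) auto
    then show ?thesis
    proof eventually_elim
      case (elim i)
      then show ?case using mpt_diff_triangle[OF E, of "f i" S R] by linarith
    qed
  qed
  then show "limitin mpt_topology f R F"
    using topspace_mpt_topology
    unfolding mpt_topology_def limitin_topology_generated_by topology_generated_by_topspace
    by auto
qed

text \<open>An action consists of classes of transformations, so the homomorphism property
  means that \<open>T\<^sup>\<beta>\<^sup>+\<^sup>\<alpha> = T\<^sup>\<beta> \<circ> T\<^sup>\<alpha>\<close> almost everywhere, and joint measurability
  is required of some choice of representatives.\<close>

definition actions :: "('g::group_add \<Rightarrow> mpt) set" where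
  "actions = {T. (\<forall>\<beta> \<alpha>. T (\<beta> + \<alpha>) = T \<beta> \<odot> T \<alpha>) \<and>
     (\<exists>t. (\<forall>\<gamma>. measure_preserving (t \<gamma>) \<and> T \<gamma> = abs_mpt (t \<gamma>)) \<and>
          (\<lambda>(\<gamma>, y). t \<gamma> y) \<in> count_space UNIV \<Otimes>\<^sub>M Y \<rightarrow>\<^sub>M Y)}"

definition coarse_topology :: "('g::group_add \<Rightarrow> mpt) topology" where
  "coarse_topology = subtopology (product_topology (\<lambda>_. mpt_topology) UNIV) actions"

lemma topspace_coarse_topology [simp]: "topspace coarse_topology = actions"
  by (simp add: coarse_topology_def)

lemma limitin_coarse_topology:
  "limitin coarse_topology T R F \<longleftrightarrow>
     R \<in> actions \<and> (\<forall>\<^sub>F i in F. T i \<in> actions) \<and>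
     (\<forall>\<gamma>. limitin mpt_topology (\<lambda>i. T i \<gamma>) (R \<gamma>) F)"
  by (auto simp: coarse_topology_def limitin_subtopology limitin_componentwise)

definition bimeasurable :: "(real \<Rightarrow> real) \<Rightarrow> bool" where
  "bimeasurable f \<longleftrightarrow> bij_betw f (space Y) (space Y) \<and>
     f \<in> Y \<rightarrow>\<^sub>M Y \<and> the_inv_into (space Y) f \<in> Y \<rightarrow>\<^sub>M Y"

definition Phi :: "mpt set" where
  "Phi = {abs_mpt f | f. bimeasurable f \<and> measure_preserving f}"

definition mpt_inverse :: "mpt \<Rightarrow> mpt" where
  "mpt_inverse \<phi> = (THE \<psi>. \<psi> \<odot> \<phi> = mpt_id \<and> \<phi> \<odot> \<psi> = mpt_id)"

definition conjugate :: "mpt \<Rightarrow> ('g \<Rightarrow> mpt) \<Rightarrow> 'g \<Rightarrow> mpt" where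
  "conjugate \<phi> T = (\<lambda>\<gamma>. \<phi> \<odot> T \<gamma> \<odot> mpt_inverse \<phi>)"

lemma mpt_inverse_eqI:
  assumes "\<psi> \<odot> \<phi> = mpt_id" "\<phi> \<odot> \<psi> = mpt_id"
  shows "mpt_inverse \<phi> = \<psi>"
  unfolding mpt_inverse_def
  by (rule the_equality) (use assms in \<open>metis mpt_comp_assoc mpt_id_comp\<close>)+

lemma measure_preserving_the_inv_into:
  assumes "bimeasurable f" "measure_preserving f"
  shows "measure_preserving (the_inv_into (space Y) f)"
  unfolding measure_preserving_def
proof safe
  let ?g = "the_inv_into (space Y) f"
  have f: "inj_on f (space Y)" "f ` space Y = space Y" and g: "?g \<in> Y \<rightarrow>\<^sub>M Y"
    using assms by (auto simp: bimeasurable_def bij_betw_def)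
  show "?g \<in> Y \<rightarrow>\<^sub>M Y" by (fact g)
  fix E assume E: "E \<in> sets Y"
  have "f -` (?g -` E \<inter> space Y) \<inter> space Y = E"
    using f sets.sets_into_space[OF E] by (auto simp: the_inv_into_f_f simp del: space_Y)
  with assms(2) measurable_sets[OF g E] show "emeasure Y (?g -` E \<inter> space Y) = emeasure Y E"
    unfolding measure_preserving_def by metis
qed

lemma mpt_inverse_abs:
  assumes "bimeasurable f" "measure_preserving f"
  shows "mpt_inverse (abs_mpt f) = abs_mpt (the_inv_into (space Y) f)"
proof (rule mpt_inverse_eqI)
  let ?g = "the_inv_into (space Y) f"
  have f: "inj_on f (space Y)" "f ` space Y = space Y"
    using assms by (auto simp: bimeasurable_def bij_betw_def)
  have g: "measure_preserving ?g"
    by (rule measure_preserving_the_inv_into[OF assms])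
  have "ae_equal (?g \<circ> f) (\<lambda>y. y)" "ae_equal (f \<circ> ?g) (\<lambda>y. y)"
    unfolding ae_equal_def using assms(2) g f
    by (auto intro!: measure_preserving_comp measure_preserving_id AE_I2
             simp: the_inv_into_f_f f_the_inv_into_f simp del: space_Y)
  then show "abs_mpt ?g \<odot> abs_mpt f = mpt_id" "abs_mpt f \<odot> abs_mpt ?g = mpt_id"
    using assms(2) g Quotient3_rel_abs[OF Quotient3_mpt]
    by (simp_all add: mpt_comp_abs mpt_id_def)
qed

definition weak_Rohlin :: "'g::group_add itself \<Rightarrow> bool" where
  "weak_Rohlin _ \<longleftrightarrow>
     (\<exists>T \<in> actions. coarse_topology closure_of {conjugate \<phi> T | \<phi>. \<phi> \<in> Phi}
        = (actions :: ('g \<Rightarrow> mpt) set))"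

definition nowhere_dense_in :: "'a topology \<Rightarrow> 'a set \<Rightarrow> bool" where
  "nowhere_dense_in X S \<longleftrightarrow> S \<subseteq> topspace X \<and> X interior_of (X closure_of S) = {}"

definition meager_in :: "'a topology \<Rightarrow> 'a set \<Rightarrow> bool" where
  "meager_in X S \<longleftrightarrow> (\<exists>N :: nat \<Rightarrow> 'a set. (\<forall>n. nowhere_dense_in X (N n)) \<and> S = (\<Union>n. N n))"

definition residual_in :: "'a topology \<Rightarrow> 'a set \<Rightarrow> bool" where
  "residual_in X S \<longleftrightarrow> S \<subseteq> topspace X \<and> meager_in X (topspace X - S)"

definition Baire_set_in :: "'a topology \<Rightarrow> 'a set \<Rightarrow> bool" where
  "Baire_set_in X S \<longleftrightarrow> (\<exists>V M. openin X V \<and> meager_in X M \<and> S = sym_diff V M)"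

definition dynamical_property :: "('g::group_add \<Rightarrow> mpt) set \<Rightarrow> bool" where
  "dynamical_property B \<longleftrightarrow>
     Baire_set_in coarse_topology B \<and> (\<forall>T\<in>B. \<forall>\<phi>\<in>Phi. conjugate \<phi> T \<in> B)"

end

theory Submission
  imports Defs
begin

text \<open>Conjugation lets \<open>\<Phi>\<close> act on the actions by homeomorphisms, and this action has a dense orbit.
  If \<open>B = V \<triangle> M\<close> is invariant with \<open>V\<close> nonempty and open, the union of the translates of \<open>V\<close> is
  open and meets every nonempty open set, so it is dense. Each translate of \<open>V\<close> is contained in
  \<open>B\<close> up to a meager set. There may be uncountably many translates, but by the Banach category
  theorem their union is still contained in \<open>B\<close> up to a meager set, so \<open>B\<close> is residual.\<close>

section \<open>Meager sets\<close>

text \<open>An open set that misses \<open>S\<close> also misses the closure of \<open>S\<close>, so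
  empty interior of the closure amounts to being able to shrink every nonempty open set away from
  \<open>S\<close>. In this form finite unions are handled by shrinking repeatedly, and pieces in
  disjoint open sets can be glued.\<close>

lemma nowhere_dense_in_iff:
  "nowhere_dense_in X S \<longleftrightarrow> S \<subseteq> topspace X \<and>
     (\<forall>U. openin X U \<and> U \<noteq> {} \<longrightarrow> (\<exists>U'. openin X U' \<and> U' \<noteq> {} \<and> U' \<subseteq> U \<and> U' \<inter> S = {}))"
proof (cases "S \<subseteq> topspace X")
  case True
  have "X interior_of (X closure_of S) = {} \<longleftrightarrow>
     (\<forall>U. openin X U \<and> U \<noteq> {} \<longrightarrow> (\<exists>U'. openin X U' \<and> U' \<noteq> {} \<and> U' \<subseteq> U \<and> U' \<inter> S = {}))"
    (is "_ \<longleftrightarrow> (\<forall>U. _ \<longrightarrow> ?R U)")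
  proof (intro iffI allI impI)
    fix U assume int: "X interior_of (X closure_of S) = {}" and U: "openin X U \<and> U \<noteq> {}"
    have "openin X (U - X closure_of S)"
      using U by (intro openin_diff) auto
    moreover have "U - X closure_of S \<noteq> {}"
      using int U interior_of_maximal[of U "X closure_of S" X] by blast
    moreover have "(U - X closure_of S) \<inter> S = {}"
      using closure_of_subset[OF True] by blast
    ultimately show "?R U" by blast
  next
    assume R: "\<forall>U. openin X U \<and> U \<noteq> {} \<longrightarrow> ?R U"
    show "X interior_of (X closure_of S) = {}"
    proof (rule ccontr)
      assume "X interior_of (X closure_of S) \<noteq> {}"
      with R obtain U' where U': "openin X U'" "U' \<noteq> {}" "U' \<subseteq> X interior_of (X closure_of S)"
          "U' \<inter> S = {}"
        using openin_interior_of[of X] by metis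
      have "U' \<inter> X closure_of S = {}"
        using U' openin_Int_closure_of_eq_empty by blast
      with U' interior_of_subset[of X "X closure_of S"] show False by blast
    qed
  qed
  with True show ?thesis by (simp add: nowhere_dense_in_def)
qed (simp add: nowhere_dense_in_def)

lemma nowhere_dense_in_subset:
  assumes "nowhere_dense_in X S" "T \<subseteq> S"
  shows "nowhere_dense_in X T"
  using assms interior_of_mono[OF closure_of_mono[OF assms(2), of X], of X]
  by (auto simp: nowhere_dense_in_def)

lemma nowhere_dense_in_Un:
  assumes "nowhere_dense_in X S" "nowhere_dense_in X T"
  shows "nowhere_dense_in X (S \<union> T)"
  unfolding nowhere_dense_in_iff
proof (intro conjI allI impI)
  show "S \<union> T \<subseteq> topspace X"
    using assms by (simp add: nowhere_dense_in_def)
  fix U assume "openin X U \<and> U \<noteq> {}"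
  then obtain U' where "openin X U'" "U' \<noteq> {}" "U' \<subseteq> U" "U' \<inter> S = {}"
    using assms(1) unfolding nowhere_dense_in_iff by blast
  moreover then obtain U'' where "openin X U''" "U'' \<noteq> {}" "U'' \<subseteq> U'" "U'' \<inter> T = {}"
    using assms(2) unfolding nowhere_dense_in_iff by blast
  ultimately show "\<exists>U'. openin X U' \<and> U' \<noteq> {} \<and> U' \<subseteq> U \<and> U' \<inter> (S \<union> T) = {}"
    by (intro exI[of _ U'']) auto
qed

lemma meager_in_nowhere_dense_in: "nowhere_dense_in X S \<Longrightarrow> meager_in X S"
  unfolding meager_in_def by (rule exI[of _ "\<lambda>_. S"]) auto

lemma meager_in_subset:
  assumes "meager_in X S" "T \<subseteq> S"
  shows "meager_in X T"
proof -
  obtain N :: "nat \<Rightarrow> _" where N: "\<And>n. nowhere_dense_in X (N n)" "S = (\<Union>n. N n)"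
    using assms by (auto simp: meager_in_def)
  have "nowhere_dense_in X (N n \<inter> T)" for n
    using N(1)[of n] by (rule nowhere_dense_in_subset) simp
  moreover have "T = (\<Union>n. N n \<inter> T)"
    using assms N by blast
  ultimately show ?thesis
    unfolding meager_in_def by (intro exI[of _ "\<lambda>n. N n \<inter> T"]) auto
qed

lemma meager_in_Un:
  assumes "meager_in X S" "meager_in X T"
  shows "meager_in X (S \<union> T)"
proof -
  obtain M N :: "nat \<Rightarrow> _" where "\<And>n. nowhere_dense_in X (M n)" "S = (\<Union>n. M n)"
      "\<And>n. nowhere_dense_in X (N n)" "T = (\<Union>n. N n)"
    using assms by (auto simp: meager_in_def)
  then show ?thesis
    unfolding meager_in_def
    by (intro exI[of _ "\<lambda>n. M n \<union> N n"]) (auto intro: nowhere_dense_in_Un)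
qed

text \<open>Homeomorphisms commute with closure and interior, hence preserve nowhere density piece
  by piece. This makes the exceptional set of a translated open set meager again.\<close>

lemma meager_in_homeomorphic_image:
  assumes h: "homeomorphic_map X Z h" and "meager_in X S"
  shows "meager_in Z (h ` S)"
proof -
  obtain N :: "nat \<Rightarrow> _" where N: "\<And>n. nowhere_dense_in X (N n)" "S = (\<Union>n. N n)"
    using assms by (auto simp: meager_in_def)
  have "nowhere_dense_in Z (h ` N n)" for n
  proof -
    have "N n \<subseteq> topspace X" "X interior_of (X closure_of N n) = {}"
      using N(1) by (auto simp: nowhere_dense_in_def)
    then show ?thesis
      using homeomorphic_imp_surjective_map[OF h] homeomorphic_map_closure_of[OF h]
        homeomorphic_map_interior_of[OF h] closure_of_subset_topspace[of X]
      unfolding nowhere_dense_in_def by (metis image_empty image_mono)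
  qed
  then show ?thesis
    unfolding meager_in_def N(2) by (intro exI[of _ "\<lambda>n. h ` N n"]) auto
qed

text \<open>Nowhere density can be tested locally, so the family may be uncountable. A nonempty open
  set either misses all members of \<D>, and then all the pieces, or meets some \<open>D\<close>;
  inside that \<open>D\<close> the only piece present is \<open>N D\<close>, since the others lie in
  members disjoint from \<open>D\<close>.\<close>

lemma nowhere_dense_in_disjoint_Union:
  assumes disj: "disjoint \<D>" and op: "\<And>D. D \<in> \<D> \<Longrightarrow> openin X D"
    and N: "\<And>D. D \<in> \<D> \<Longrightarrow> N D \<subseteq> D \<and> nowhere_dense_in X (N D)"
  shows "nowhere_dense_in X (\<Union>D\<in>\<D>. N D)"
  unfolding nowhere_dense_in_iff
proof (intro conjI allI impI)
  show "(\<Union>D\<in>\<D>. N D) \<subseteq> topspace X"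
    using N by (auto simp: nowhere_dense_in_def)
  fix U assume U: "openin X U \<and> U \<noteq> {}"
  show "\<exists>U'. openin X U' \<and> U' \<noteq> {} \<and> U' \<subseteq> U \<and> U' \<inter> (\<Union>D\<in>\<D>. N D) = {}"
  proof (cases "U \<inter> \<Union>\<D> = {}")
    case True
    with U N show ?thesis by (intro exI[of _ U]) blast
  next
    case False
    then obtain D where D: "D \<in> \<D>" "U \<inter> D \<noteq> {}" by blast
    then have "openin X (U \<inter> D)" using U op by blast
    with N D obtain U' where U': "openin X U'" "U' \<noteq> {}" "U' \<subseteq> U \<inter> D" "U' \<inter> N D = {}"
      unfolding nowhere_dense_in_iff by metis
    have "U' \<inter> N D' = {}" if "D' \<in> \<D>" for D'
    proof (cases "D' = D")
      case False
      with disj that D(1) have "D' \<inter> D = {}" by (simp add: disjoint_def)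
      with N[OF that] U' show ?thesis by blast
    qed (use U' in simp)
    with U' show ?thesis by (intro exI[of _ U']) blast
  qed
qed

text \<open>The Banach category theorem, localized to a set \<open>S\<close>. A maximal disjoint family of nonempty open
  sets in which \<open>S\<close> is meager covers \<open>\<Union>\<O>\<close> up to a nowhere dense set, and disjointness allows
  the nowhere dense pieces of \<open>S\<close> to be glued index by index.\<close>

lemma meager_in_Union_open_Int:
  assumes op: "\<And>U. U \<in> \<O> \<Longrightarrow> openin X U" and mg: "\<And>U. U \<in> \<O> \<Longrightarrow> meager_in X (U \<inter> S)"
  shows "meager_in X (\<Union>\<O> \<inter> S)"
proof -
  define \<A> where
    "\<A> = {\<C>. disjoint \<C> \<and> (\<forall>D\<in>\<C>. openin X D \<and> D \<noteq> {} \<and> meager_in X (D \<inter> S))}"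
  have "\<exists>\<D>\<in>\<A>. \<forall>\<C>\<in>\<A>. \<D> \<subseteq> \<C> \<longrightarrow> \<C> = \<D>"
  proof (rule subset_Zorn_nonempty)
    show "\<A> \<noteq> {}"
      by (auto simp: \<A>_def disjoint_def intro!: exI[of _ "{}"])
    fix \<K> assume "\<K> \<noteq> {}" "subset.chain \<A> \<K>"
    \<comment> \<open>Disjointness is a condition on pairs, and any two members of
      \<open>\<Union>\<K>\<close> already lie in a common family of the chain.\<close>
    then show "\<Union>\<K> \<in> \<A>"
      using pairwise_chain_Union[of \<K> disjnt] unfolding \<A>_def subset_chain_def
      by (auto simp: chain_subset_def)
  qed
  then obtain \<D> where \<D>: "\<D> \<in> \<A>" and max: "\<And>\<C>. \<C> \<in> \<A> \<Longrightarrow> \<D> \<subseteq> \<C> \<Longrightarrow> \<C> = \<D>"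
    by blast
  have opD: "openin X D" if "D \<in> \<D>" for D
    using \<D> that by (simp add: \<A>_def)
  have "\<exists>N :: nat \<Rightarrow> _. (\<forall>n. nowhere_dense_in X (N n)) \<and> D \<inter> S = (\<Union>n. N n)" if "D \<in> \<D>" for D
    using \<D> that by (simp add: \<A>_def meager_in_def)
  then obtain N :: "_ \<Rightarrow> nat \<Rightarrow> _" where
    N: "\<And>D n. D \<in> \<D> \<Longrightarrow> nowhere_dense_in X (N D n)" "\<And>D. D \<in> \<D> \<Longrightarrow> D \<inter> S = (\<Union>n. N D n)"
    by metis
  have "nowhere_dense_in X (\<Union>D\<in>\<D>. N D n)" for n
  proof (rule nowhere_dense_in_disjoint_Union)
    show "disjoint \<D>" using \<D> by (simp add: \<A>_def)
    show "N D n \<subseteq> D \<and> nowhere_dense_in X (N D n)" if "D \<in> \<D>" for D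
      using N[OF that] by blast
  qed (rule opD)
  moreover have "\<Union>\<D> \<inter> S = (\<Union>n. \<Union>D\<in>\<D>. N D n)"
    using N(2) by blast
  ultimately have "meager_in X (\<Union>\<D> \<inter> S)"
    unfolding meager_in_def by (intro exI[of _ "\<lambda>n. \<Union>D\<in>\<D>. N D n"]) simp
  moreover have "nowhere_dense_in X (\<Union>\<O> - \<Union>\<D>)"
    unfolding nowhere_dense_in_iff
  proof (intro conjI allI impI)
    show "\<Union>\<O> - \<Union>\<D> \<subseteq> topspace X"
      using op openin_subset by blast
    fix U assume U: "openin X U \<and> U \<noteq> {}"
    \<comment> \<open>This is where maximality enters: if \<open>U\<close> missed
      \<open>\<Union>\<D>\<close>, the nonempty open set \<open>U \<inter> O'\<close>, in which
      \<open>S\<close> is meager, could be adjoined to \<D>. By maximality it would already belong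
      to \<D>, contradicting that \<open>U\<close> misses \<open>\<Union>\<D>\<close>.\<close>
    have "U \<inter> \<Union>\<D> \<noteq> {}" if "O' \<in> \<O>" "U \<inter> O' \<noteq> {}" for O'
    proof
      assume UD: "U \<inter> \<Union>\<D> = {}"
      have "meager_in X (U \<inter> O' \<inter> S)"
        using mg[OF that(1)] by (rule meager_in_subset) auto
      with UD U op that \<D> have "insert (U \<inter> O') \<D> \<in> \<A>"
        by (auto simp: \<A>_def disjoint_def)
      with max have "U \<inter> O' \<in> \<D>" by blast
      with UD that show False by blast
    qed
    then have *: "U \<inter> \<Union>\<D> \<noteq> {} \<or> U \<inter> \<Union>\<O> = {}" by blast
    have "openin X (U \<inter> \<Union>\<D>)"
      using U opD by blast
    from * show "\<exists>U'. openin X U' \<and> U' \<noteq> {} \<and> U' \<subseteq> U \<and> U' \<inter> (\<Union>\<O> - \<Union>\<D>) = {}"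
    proof
      assume "U \<inter> \<Union>\<D> \<noteq> {}"
      with \<open>openin X (U \<inter> \<Union>\<D>)\<close> show ?thesis
        by (intro exI[of _ "U \<inter> \<Union>\<D>"]) auto
    next
      assume "U \<inter> \<Union>\<O> = {}"
      with U show ?thesis
        by (intro exI[of _ U]) auto
    qed
  qed
  then have "meager_in X (\<Union>\<O> - \<Union>\<D>)"
    by (rule meager_in_nowhere_dense_in)
  ultimately have "meager_in X (\<Union>\<D> \<inter> S \<union> (\<Union>\<O> - \<Union>\<D>))"
    by (rule meager_in_Un)
  then show ?thesis
    by (rule meager_in_subset) blast
qed

section \<open>An abstract zero-one law for homeomorphisms with a dense orbit\<close>

theorem topological_zero_one_law:
  assumes homeo: "\<And>h. h \<in> H \<Longrightarrow> homeomorphic_map X X h"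
    and trans: "\<And>h k. h \<in> H \<Longrightarrow> k \<in> H \<Longrightarrow> \<exists>l\<in>H. l (h x) = k x"
    and dense: "X closure_of {h x | h. h \<in> H} = topspace X"
    and B: "B \<subseteq> topspace X" "Baire_set_in X B" "\<And>h. h \<in> H \<Longrightarrow> h ` B \<subseteq> B"
  shows "meager_in X B \<or> residual_in X B"
proof -
  obtain V M where V: "openin X V" and M: "meager_in X M" and B_eq: "B = sym_diff V M"
    using B(2) by (auto simp: Baire_set_in_def)
  have meets: "\<exists>h\<in>H. h x \<in> U" if "openin X U" "U \<noteq> {}" for U
    using that openin_Int_closure_of_eq_empty[of X U "{h x | h. h \<in> H}"] dense openin_subset
    by blast
  show ?thesis
  proof (cases "V = {}")
    case True
    with M B_eq show ?thesis by simp
  next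
    case False
    define \<O> where "\<O> = {h ` V | h. h \<in> H}"
    have opn: "openin X U" if "U \<in> \<O>" for U
      using that homeo homeomorphic_map_openness_eq[of X X _ V] V openin_subset[OF V]
      by (auto simp: \<O>_def)
    have "meager_in X (\<Union>\<O> \<inter> (topspace X - B))"
    proof (rule meager_in_Union_open_Int)
      fix U assume "U \<in> \<O>"
      then obtain h where h: "h \<in> H" "U = h ` V" by (auto simp: \<O>_def)
      have "meager_in X (h ` M)"
        using homeo[OF h(1)] M by (rule meager_in_homeomorphic_image)
      \<comment> \<open>Since \<open>V \<subseteq> B \<union> M\<close>, applying \<open>h\<close>
        gives \<open>h\<close> V \<subseteq> h \<open>B \<union> h\<close> M\<open>, and\<close>h
        \<open>B\<close> stays inside \<open>B\<close>.\<close>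
      moreover have "U \<inter> (topspace X - B) \<subseteq> h ` M"
        using h B(3)[OF h(1)] B_eq by blast
      ultimately show "meager_in X (U \<inter> (topspace X - B))"
        by (rule meager_in_subset)
    qed (rule opn)
    moreover have "nowhere_dense_in X (topspace X - \<Union>\<O>)"
      unfolding nowhere_dense_in_iff
    proof (intro conjI allI impI)
      fix U assume U: "openin X U \<and> U \<noteq> {}"
      obtain h where h: "h \<in> H" "h x \<in> V" using meets V False by blast
      obtain k where k: "k \<in> H" "k x \<in> U" using meets U by blast
      obtain l where "l \<in> H" "l (h x) = k x" using trans h k by blast
      then have "k x \<in> l ` V" "l ` V \<in> \<O>"
        using h(2) by (metis imageI) (use \<open>l \<in> H\<close> in \<open>auto simp: \<O>_def\<close>)
      then have "k x \<in> \<Union>\<O>" by blast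
      moreover have "openin X (U \<inter> \<Union>\<O>)"
        using U opn by blast
      ultimately show "\<exists>U'. openin X U' \<and> U' \<noteq> {} \<and> U' \<subseteq> U \<and> U' \<inter> (topspace X - \<Union>\<O>) = {}"
        using k by (intro exI[of _ "U \<inter> \<Union>\<O>"]) blast
    qed simp
    \<comment> \<open>The complement of \<open>B\<close> is split into its part inside the union of
      the translates and its part outside.\<close>
    ultimately have "meager_in X (\<Union>\<O> \<inter> (topspace X - B) \<union> (topspace X - \<Union>\<O>))"
      by (simp add: meager_in_Un meager_in_nowhere_dense_in)
    then have "meager_in X (topspace X - B)"
      by (rule meager_in_subset) blast
    with B(1) show ?thesis by (simp add: residual_in_def)
  qed
qed

section \<open>Conjugation of actions\<close>

lemma mpt_cases:
  obtains f where "measure_preserving f" "T = abs_mpt f"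
  using that[OF rep_mpt_measure_preserving[of T]] by (simp add: Quotient3_abs_rep[OF Quotient3_mpt])

lemma abs_mpt_eqI:
  assumes "measure_preserving f" "measure_preserving g" "\<And>y. y \<in> space Y \<Longrightarrow> f y = g y"
  shows "abs_mpt f = abs_mpt g"
  using assms by (intro Quotient3_rel_abs[OF Quotient3_mpt]) (auto simp: ae_equal_def intro!: AE_I2)

text \<open>Naming the inverse \<open>g\<close> makes the description symmetric in \<open>f\<close>
  and \<open>g\<close>, so closure of \<open>Phi\<close> under inverses and composition can be read
  off from representatives.\<close>

lemma Phi_iff:
  "\<phi> \<in> Phi \<longleftrightarrow> (\<exists>f g. measure_preserving f \<and> measure_preserving g \<and> \<phi> = abs_mpt f \<and>
     (\<forall>y\<in>space Y. g (f y) = y \<and> f (g y) = y))"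
proof safe
  assume "\<phi> \<in> Phi"
  then obtain f where f: "bimeasurable f" "measure_preserving f" "\<phi> = abs_mpt f"
    by (auto simp: Phi_def)
  then have "inj_on f (space Y)" "f ` space Y = space Y"
    by (auto simp: bimeasurable_def bij_betw_def)
  with f measure_preserving_the_inv_into[OF f(1,2)]
  show "\<exists>f g. measure_preserving f \<and> measure_preserving g \<and> \<phi> = abs_mpt f \<and>
     (\<forall>y\<in>space Y. g (f y) = y \<and> f (g y) = y)"
    by (intro exI[of _ f] exI[of _ "the_inv_into (space Y) f"])
      (auto simp: the_inv_into_f_f f_the_inv_into_f simp del: space_Y)
next
  fix f g assume f: "measure_preserving f" and g: "measure_preserving g"
    and inv: "\<forall>y\<in>space Y. g (f y) = y \<and> f (g y) = y"
  have f': "f \<in> Y \<rightarrow>\<^sub>M Y" and g': "g \<in> Y \<rightarrow>\<^sub>M Y"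
    using f g by (auto simp: measure_preserving_def)
  have bij: "bij_betw f (space Y) (space Y)"
    using inv measurable_space[OF f'] measurable_space[OF g']
    by (intro bij_betw_byWitness[where f' = g]) auto
  have "the_inv_into (space Y) f y = g y" if "y \<in> space Y" for y
    using bij that inv measurable_space[OF g' that]
    by (intro the_inv_into_f_eq) (auto simp: bij_betw_def)
  \<comment> \<open>Measurability from \<open>Y\<close> depends only on the values on
    \<open>space Y\<close>, where \<open>the_inv_into\<close> agrees with \<open>g\<close>.\<close>
  then have "the_inv_into (space Y) f \<in> Y \<rightarrow>\<^sub>M Y"
    using g' by (subst measurable_cong[where g = g])
  with f f' bij show "abs_mpt f \<in> Phi"
    by (auto simp: Phi_def bimeasurable_def)
qed

lemma Phi_inverse:
  assumes "\<phi> \<in> Phi"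
  shows "mpt_inverse \<phi> \<in> Phi" "mpt_inverse \<phi> \<odot> \<phi> = mpt_id" "\<phi> \<odot> mpt_inverse \<phi> = mpt_id"
proof -
  obtain f g where f: "measure_preserving f" "measure_preserving g" "\<phi> = abs_mpt f"
      and inv: "\<forall>y\<in>space Y. g (f y) = y \<and> f (g y) = y"
    using assms by (auto simp: Phi_iff)
  have 1: "abs_mpt g \<odot> \<phi> = mpt_id" and 2: "\<phi> \<odot> abs_mpt g = mpt_id"
    unfolding f(3) mpt_id_def using f inv
    by (auto simp: mpt_comp_abs simp del: space_Y
        intro!: abs_mpt_eqI measure_preserving_comp measure_preserving_id)
  then have 3: "mpt_inverse \<phi> = abs_mpt g"
    by (rule mpt_inverse_eqI)
  show "mpt_inverse \<phi> \<in> Phi"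
    unfolding 3 Phi_iff using f inv by blast
  show "mpt_inverse \<phi> \<odot> \<phi> = mpt_id" "\<phi> \<odot> mpt_inverse \<phi> = mpt_id"
    unfolding 3 by fact+
qed

lemma Phi_comp:
  assumes "\<phi> \<in> Phi" "\<psi> \<in> Phi"
  shows "\<phi> \<odot> \<psi> \<in> Phi"
proof -
  obtain f f' where f: "measure_preserving f" "measure_preserving f'" "\<phi> = abs_mpt f"
      "\<forall>y\<in>space Y. f' (f y) = y \<and> f (f' y) = y"
    using assms by (auto simp: Phi_iff)
  obtain g g' where g: "measure_preserving g" "measure_preserving g'" "\<psi> = abs_mpt g"
      "\<forall>y\<in>space Y. g' (g y) = y \<and> g (g' y) = y"
    using assms by (auto simp: Phi_iff)
  have "f' y \<in> space Y" "g y \<in> space Y" if "y \<in> space Y" for y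
    using f g that measurable_space by (auto simp: measure_preserving_def simp del: space_Y)
  with f g show ?thesis
    unfolding Phi_iff
    by (intro exI[of _ "f \<circ> g"] exI[of _ "g' \<circ> f'"])
      (auto simp: mpt_comp_abs simp del: space_Y intro!: measure_preserving_comp)
qed

lemma mpt_inverse_inverse:
  assumes "\<phi> \<in> Phi"
  shows "mpt_inverse (mpt_inverse \<phi>) = \<phi>"
  using Phi_inverse[OF assms] by (intro mpt_inverse_eqI)

lemma mpt_inverse_comp:
  assumes "\<phi> \<in> Phi" "\<psi> \<in> Phi"
  shows "mpt_inverse (\<phi> \<odot> \<psi>) = mpt_inverse \<psi> \<odot> mpt_inverse \<phi>"
proof (rule mpt_inverse_eqI)
  have "mpt_inverse \<psi> \<odot> mpt_inverse \<phi> \<odot> (\<phi> \<odot> \<psi>) = mpt_inverse \<psi> \<odot> (mpt_inverse \<phi> \<odot> \<phi>) \<odot> \<psi>"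
    by (simp only: mpt_comp_assoc)
  then show "mpt_inverse \<psi> \<odot> mpt_inverse \<phi> \<odot> (\<phi> \<odot> \<psi>) = mpt_id"
    using assms by (simp add: Phi_inverse)
  have "\<phi> \<odot> \<psi> \<odot> (mpt_inverse \<psi> \<odot> mpt_inverse \<phi>) = \<phi> \<odot> (\<psi> \<odot> mpt_inverse \<psi>) \<odot> mpt_inverse \<phi>"
    by (simp only: mpt_comp_assoc)
  then show "\<phi> \<odot> \<psi> \<odot> (mpt_inverse \<psi> \<odot> mpt_inverse \<phi>) = mpt_id"
    using assms by (simp add: Phi_inverse)
qed

section \<open>Conjugation as an action by homeomorphisms\<close>

lemma conjugate_conjugate:
  assumes "\<phi> \<in> Phi" "\<psi> \<in> Phi"
  shows "conjugate \<phi> (conjugate \<psi> T) = conjugate (\<phi> \<odot> \<psi>) T"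
  using assms by (simp add: conjugate_def mpt_inverse_comp mpt_comp_assoc)

lemma conjugate_inverse:
  assumes "\<phi> \<in> Phi"
  shows "conjugate (mpt_inverse \<phi>) (conjugate \<phi> T) = T"
    "conjugate \<phi> (conjugate (mpt_inverse \<phi>) T) = T"
proof -
  have "mpt_inverse mpt_id = mpt_id"
    by (rule mpt_inverse_eqI) simp_all
  then have "conjugate mpt_id T = T"
    by (simp add: conjugate_def)
  with assms show "conjugate (mpt_inverse \<phi>) (conjugate \<phi> T) = T"
    "conjugate \<phi> (conjugate (mpt_inverse \<phi>) T) = T"
    by (simp_all add: conjugate_conjugate Phi_inverse)
qed

text \<open>The homomorphism law survives because the inner factors
  \<open>mpt_inverse \<phi> \<odot> \<phi>\<close> cancel. For joint measurability, representatives
  of the conjugated action are built from jointly measurable ones of \<open>T\<close> by composing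
  with fixed representatives of \<phi> and its inverse.\<close>

lemma conjugate_in_actions:
  assumes \<phi>: "\<phi> \<in> Phi" and T: "T \<in> actions"
  shows "conjugate \<phi> T \<in> actions"
proof -
  obtain f where f: "measure_preserving f" "\<phi> = abs_mpt f" by (rule mpt_cases)
  obtain g where g: "measure_preserving g" "mpt_inverse \<phi> = abs_mpt g" by (rule mpt_cases)
  obtain t where t: "\<And>\<gamma>. measure_preserving (t \<gamma>)" "\<And>\<gamma>. T \<gamma> = abs_mpt (t \<gamma>)"
      and tm: "(\<lambda>(\<gamma>, y). t \<gamma> y) \<in> count_space UNIV \<Otimes>\<^sub>M Y \<rightarrow>\<^sub>M Y"
    using T by (auto simp: actions_def)
  have hom: "T (\<beta> + \<alpha>) = T \<beta> \<odot> T \<alpha>" for \<alpha> \<beta>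
    using T by (auto simp: actions_def)
  have "conjugate \<phi> T (\<beta> + \<alpha>) = conjugate \<phi> T \<beta> \<odot> conjugate \<phi> T \<alpha>" for \<alpha> \<beta>
    unfolding conjugate_def hom using Phi_inverse(2)[OF \<phi>] by (metis mpt_comp_assoc mpt_id_comp(2))
  moreover have "measure_preserving (f \<circ> t \<gamma> \<circ> g)" for \<gamma>
    using f g t by (intro measure_preserving_comp)
  moreover have "conjugate \<phi> T \<gamma> = abs_mpt (f \<circ> t \<gamma> \<circ> g)" for \<gamma>
    unfolding conjugate_def t(2) f(2)[symmetric] g(2)
    unfolding f(2) using f g t by (simp add: mpt_comp_abs measure_preserving_comp)
  moreover have "(\<lambda>(\<gamma>, y). (f \<circ> t \<gamma> \<circ> g) y) \<in> count_space UNIV \<Otimes>\<^sub>M Y \<rightarrow>\<^sub>M Y"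
  proof -
    have f': "f \<in> Y \<rightarrow>\<^sub>M Y" and g'[measurable]: "g \<in> Y \<rightarrow>\<^sub>M Y"
      using f g by (auto simp: measure_preserving_def)
    \<comment> \<open>The joint map is factored as this one, followed by the joint map of
      \<open>t\<close>, followed by \<open>f\<close>.\<close>
    have "(\<lambda>(\<gamma>, y). (\<gamma>, g y)) \<in> count_space UNIV \<Otimes>\<^sub>M Y \<rightarrow>\<^sub>M count_space UNIV \<Otimes>\<^sub>M Y"
      by measurable
    from measurable_compose[OF this measurable_compose[OF tm f']] show ?thesis
      by (simp add: case_prod_beta)
  qed
  ultimately show ?thesis
    unfolding actions_def by (intro CollectI conjI allI exI[of _ "\<lambda>\<gamma>. f \<circ> t \<gamma> \<circ> g"])
qed

text \<open>Preimages compose in reverse order: the left factor \<phi> merely replaces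
  \<open>E\<close> by its preimage, while the right factor \<psi> pulls the whole symmetric
  difference back and so leaves its measure unchanged.\<close>

lemma mpt_diff_comp:
  assumes E: "E \<in> sets Y"
  shows "mpt_diff E (\<phi> \<odot> S \<odot> \<psi>) (\<phi> \<odot> R \<odot> \<psi>) = mpt_diff (rep_mpt \<phi> -` E \<inter> space Y) S R"
proof -
  define f s r g where "f = rep_mpt \<phi>" "s = rep_mpt S" "r = rep_mpt R" "g = rep_mpt \<psi>"
  note defs = f_s_r_g_def
  have mp: "measure_preserving f" "measure_preserving s" "measure_preserving r" "measure_preserving g"
    by (simp_all add: defs rep_mpt_measure_preserving)
  have eqs: "\<phi> = abs_mpt f" "S = abs_mpt s" "R = abs_mpt r" "\<psi> = abs_mpt g"
    using Quotient3_abs_rep[OF Quotient3_mpt] by (simp_all add: defs)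
  have ms: "f \<in> Y \<rightarrow>\<^sub>M Y" "s \<in> Y \<rightarrow>\<^sub>M Y" "r \<in> Y \<rightarrow>\<^sub>M Y" "g \<in> Y \<rightarrow>\<^sub>M Y"
    using mp by (auto simp: measure_preserving_def)
  define F where "F = f -` E \<inter> space Y"
  define D where "D = sym_diff (s -` F \<inter> space Y) (r -` F \<inter> space Y)"
  have F: "F \<in> sets Y"
    unfolding F_def using ms(1) E by (rule measurable_sets)
  have D: "D \<in> sets Y"
    unfolding D_def using ms F by (intro sets.Un sets.Diff measurable_sets)
  have "mpt_diff E (\<phi> \<odot> S \<odot> \<psi>) (\<phi> \<odot> R \<odot> \<psi>) =
      measure Y (sym_diff ((f \<circ> s \<circ> g) -` E \<inter> space Y) ((f \<circ> r \<circ> g) -` E \<inter> space Y))"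
    unfolding eqs using mp E by (simp add: mpt_comp_abs measure_preserving_comp mpt_diff_abs del: space_Y)
  also have "sym_diff ((f \<circ> s \<circ> g) -` E \<inter> space Y) ((f \<circ> r \<circ> g) -` E \<inter> space Y) = g -` D \<inter> space Y"
    unfolding D_def F_def
    using measurable_space[OF ms(4)] measurable_space[OF ms(3)] measurable_space[OF ms(2)]
    by (auto simp del: space_Y)
  also have "measure Y \<dots> = measure Y D"
    using mp(4) D by (simp add: measure_preserving_def measure_def)
  also have "\<dots> = mpt_diff F S R"
    by (simp add: mpt_diff_def D_def defs)
  finally show ?thesis by (simp add: F_def defs)
qed

text \<open>The preimage of a subbasic ball is again a subbasic ball, with a different test set and
  a different center.\<close>

lemma continuous_map_conjugation:
  assumes "\<phi> \<in> Phi"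
  shows "continuous_map mpt_topology mpt_topology (\<lambda>S. \<phi> \<odot> S \<odot> mpt_inverse \<phi>)"
  (is "continuous_map _ _ ?c")
proof -
  have "continuous_map mpt_topology (topology_generated_by {{T. mpt_diff E T R < \<epsilon>} | E R \<epsilon>.
      E \<in> sets Y \<and> 0 < \<epsilon>}) ?c"
  proof (rule continuous_on_generated_topo, goal_cases)
    case (1 U)
    then obtain E R \<epsilon> where U: "U = {T. mpt_diff E T R < \<epsilon>}" and E: "E \<in> sets Y" "0 < \<epsilon>"
      by blast
    define F where "F = rep_mpt \<phi> -` E \<inter> space Y"
    \<comment> \<open>The new center is the point that conjugation sends to \<open>R\<close>;
      writing \<open>R\<close> as a conjugate brings the distance to \<open>R\<close> into the form
      treated by \<open>mpt_diff_comp\<close>.\<close>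
    define R' where "R' = mpt_inverse \<phi> \<odot> R \<odot> \<phi>"
    have F: "F \<in> sets Y"
      using rep_mpt_measure_preserving[of \<phi>] E
      by (auto simp: F_def measure_preserving_def simp del: space_Y intro!: measurable_sets)
    have "\<phi> \<odot> R' \<odot> mpt_inverse \<phi> = R"
      using Phi_inverse[OF assms] unfolding R'_def by (metis mpt_comp_assoc mpt_id_comp)
    then have "mpt_diff E (?c T) R = mpt_diff F T R'" for T
      using mpt_diff_comp[OF E(1), of \<phi> T "mpt_inverse \<phi>" R'] by (simp add: F_def)
    then have "?c -` U \<inter> topspace mpt_topology = {T. mpt_diff F T R' < \<epsilon>}"
      by (simp add: U vimage_def)
    then show ?case
      using E F unfolding mpt_topology_def by (auto intro!: topology_generated_by_Basis)
  next
    case 2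
    then show ?case
      using topspace_mpt_topology unfolding mpt_topology_def topology_generated_by_topspace by auto
  qed
  then show ?thesis by (simp add: mpt_topology_def)
qed

text \<open>The coarse topology is a subspace of a product, and conjugation acts on every coordinate
  by the same continuous map.\<close>

lemma continuous_map_conjugate:
  assumes "\<phi> \<in> Phi"
  shows "continuous_map coarse_topology coarse_topology
    (conjugate \<phi> :: ('g::group_add \<Rightarrow> mpt) \<Rightarrow> 'g \<Rightarrow> mpt)"
proof -
  have "continuous_map coarse_topology mpt_topology (\<lambda>T. T \<gamma>)" for \<gamma> :: 'g
    unfolding coarse_topology_def
    by (intro continuous_map_from_subtopology continuous_map_product_projection) simp
  from continuous_map_compose[OF this continuous_map_conjugation[OF assms]]
  have "continuous_map coarse_topology (product_topology (\<lambda>_. mpt_topology) UNIV)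
      (conjugate \<phi> :: ('g \<Rightarrow> mpt) \<Rightarrow> 'g \<Rightarrow> mpt)"
    by (simp add: continuous_map_componentwise_UNIV conjugate_def o_def)
  then show ?thesis
    using conjugate_in_actions[OF assms]
    by (subst (2) coarse_topology_def) (auto simp: continuous_map_in_subtopology)
qed

lemma homeomorphic_map_conjugate:
  assumes "\<phi> \<in> Phi"
  shows "homeomorphic_map coarse_topology coarse_topology
    (conjugate \<phi> :: ('g::group_add \<Rightarrow> mpt) \<Rightarrow> 'g \<Rightarrow> mpt)"
proof -
  have "homeomorphic_maps coarse_topology coarse_topology
      (conjugate \<phi> :: ('g \<Rightarrow> mpt) \<Rightarrow> 'g \<Rightarrow> mpt) (conjugate (mpt_inverse \<phi>))"
    using assms Phi_inverse(1)[OF assms]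
    by (auto simp: homeomorphic_maps_def continuous_map_conjugate conjugate_inverse)
  then show ?thesis by (rule homeomorphic_maps_imp_map)
qed

section \<open>The zero-one law for dynamical properties\<close>

theorem mainTheorem1:
  fixes B :: "('g::{group_add, countable} \<Rightarrow> mpt) set"
  assumes "weak_Rohlin TYPE('g)"
    and "B \<subseteq> actions"
    and "dynamical_property B"
  shows "meager_in coarse_topology B \<or> residual_in coarse_topology B"
proof -
  obtain T :: "'g \<Rightarrow> mpt" where
    T: "coarse_topology closure_of {conjugate \<phi> T | \<phi>. \<phi> \<in> Phi} = actions"
    using assms(1) by (auto simp: weak_Rohlin_def)
  show ?thesis
  proof (rule topological_zero_one_law[where H = "conjugate ` Phi" and x = T])
    fix h k :: "('g \<Rightarrow> mpt) \<Rightarrow> 'g \<Rightarrow> mpt" assume "h \<in> conjugate ` Phi" "k \<in> conjugate ` Phi"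
    then obtain \<phi> \<psi> where *: "\<phi> \<in> Phi" "h = conjugate \<phi>" "\<psi> \<in> Phi" "k = conjugate \<psi>"
      by blast
    \<comment> \<open>Transitivity on the orbit: first undo the conjugation by \<phi> to return to
      \<open>T\<close>, then conjugate by \<psi>.\<close>
    then have "conjugate (\<psi> \<odot> mpt_inverse \<phi>) (h T) = k T"
      by (simp add: conjugate_conjugate[symmetric] conjugate_inverse Phi_inverse(1))
    with * show "\<exists>l\<in>conjugate ` Phi. l (h T) = k T"
      by (blast intro: Phi_comp Phi_inverse(1))
  next
    have "{h T | h. h \<in> conjugate ` Phi} = {conjugate \<phi> T | \<phi>. \<phi> \<in> Phi}"
      by blast
    with T show "coarse_topology closure_of {h T | h. h \<in> conjugate ` Phi} = topspace coarse_topology"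
      by simp
  qed (use assms in \<open>auto simp: dynamical_property_def homeomorphic_map_conjugate\<close>)
qed

end
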